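(* Let $1\le k\le n$ and let $X\in\mathrm{Sp}(2k,2n)$. If a tangent vector $Z\in\mathrm{T}_X\mathrm{Sp}(2k,2n)$ satisfies $\|Z\|_2<1$, then $X+Z$ has an SR decomposition.
   Context: For $m\ge 1$, $J_{2m}=\begin{bmatrix}0&I_m\\-I_m&0\end{bmatrix}$. $\mathrm{Sp}(2k,2n)=\{X\in\mathbb{R}^{2n\times 2k} : X^TJ_{2n}X=J_{2k}\}$, with tangent space at $X$ given by $\mathrm{T}_X\mathrm{Sp}(2k,2n)=\{Z\in\mathbb{R}^{2n\times 2k} : Z^TJ_{2n}X+X^TJ_{2n}Z=0\}$. $\|\cdot\|_2$ is the spectral matrix norm. $P_{2k}=[e_1,e_3,\ldots,e_{2k-1},e_2,e_4,\ldots,e_{2k}]\in\mathbb{R}^{2k\times 2k}$, where $e_j$ is the $j$-th canonical basis vector of $\mathbb{R}^{2k}$. An SR decomposition of $A\in\mathbb{R}^{2n\times 2k}$ is a factorization $A=SR$ with $S\in\mathrm{Sp}(2k,2n)$ and $R\in T_{2k}(P_{2k})=\{P_{2k}^T\hat R P_{2k} : \hat R\in\mathbb{R}^{2k\times 2k}\text{ is upper triangular}\}$. *)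

theory Defs
  imports "Jordan_Normal_Form.Matrix"
begin

definition J_mat :: "nat \<Rightarrow> real mat" where
  "J_mat m = four_block_mat (0\<^sub>m m m) (1\<^sub>m m) (- 1\<^sub>m m) (0\<^sub>m m m)"

(* Argument order as in Sp(2k,2n): the elements are 2n x 2k matrices. *)
definition Sp :: "nat \<Rightarrow> nat \<Rightarrow> real mat set" where
  "Sp k n = {X \<in> carrier_mat (2 * n) (2 * k).
     transpose_mat X * J_mat n * X = J_mat k}"

definition tangent_Sp :: "nat \<Rightarrow> nat \<Rightarrow> real mat \<Rightarrow> real mat set" where
  "tangent_Sp k n X = {Z \<in> carrier_mat (2 * n) (2 * k).
     transpose_mat Z * J_mat n * X + transpose_mat X * J_mat n * Z = 0\<^sub>m (2 * k) (2 * k)}"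

definition euclid_norm :: "real vec \<Rightarrow> real" where
  "euclid_norm v = sqrt (v \<bullet> v)"

(* The operator norm induced by the Euclidean norms. The supremum is over the closed unit
   ball, which is nonempty also in dimension 0; the lemma below shows it is a genuine
   supremum. *)
definition spectral_norm :: "real mat \<Rightarrow> real" where
  "spectral_norm A =
     (SUP v \<in> {v \<in> carrier_vec (dim_col A). euclid_norm v \<le> 1}. euclid_norm (A *\<^sub>v v))"

lemma spectral_norm_bdd_above:
  "bdd_above ((\<lambda>v. euclid_norm (A *\<^sub>v v)) `
     {v \<in> carrier_vec (dim_col A). euclid_norm v \<le> 1})"
proof (rule bdd_aboveI2)
  fix v assume "v \<in> {v \<in> carrier_vec (dim_col A). euclid_norm v \<le> 1}"
  then have dv: "dim_vec v = dim_col A" and vv: "v \<bullet> v \<le> 1"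
    by (auto simp: euclid_norm_def)
  have vj: "\<bar>v $ j\<bar> \<le> 1" if "j < dim_col A" for j
  proof -
    have "v $ j * v $ j \<le> v \<bullet> v"
      unfolding scalar_prod_def
      by (rule member_le_sum[of j "{0..<dim_vec v}" "\<lambda>i. v $ i * v $ i"])
         (use that dv in auto)
    then show ?thesis
      using vv by (simp add: abs_square_le_1[symmetric] power2_eq_square)
  qed
  have "\<bar>(A *\<^sub>v v) $ i\<bar> \<le> (\<Sum>j<dim_col A. \<bar>A $$ (i, j)\<bar>)" if "i < dim_row A" for i
  proof -
    have "(A *\<^sub>v v) $ i = (\<Sum>j<dim_col A. A $$ (i, j) * v $ j)"
      using that dv by (simp add: scalar_prod_def atLeast0LessThan)
    also have "\<bar>\<dots>\<bar> \<le> (\<Sum>j<dim_col A. \<bar>A $$ (i, j) * v $ j\<bar>)"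
      by (rule sum_abs)
    also have "\<dots> \<le> (\<Sum>j<dim_col A. \<bar>A $$ (i, j)\<bar>)"
      by (rule sum_mono) (use vj in \<open>auto simp: abs_mult mult_left_le\<close>)
    finally show ?thesis .
  qed
  then have "(A *\<^sub>v v) \<bullet> (A *\<^sub>v v) \<le> (\<Sum>i<dim_row A. (\<Sum>j<dim_col A. \<bar>A $$ (i, j)\<bar>)\<^sup>2)"
    unfolding scalar_prod_def dim_mult_mat_vec atLeast0LessThan
    by (intro sum_mono) (metis abs_ge_zero lessThan_iff power2_abs power2_eq_square power_mono)
  then show "euclid_norm (A *\<^sub>v v) \<le> sqrt (\<Sum>i<dim_row A. (\<Sum>j<dim_col A. \<bar>A $$ (i, j)\<bar>)\<^sup>2)"
    unfolding euclid_norm_def by (rule real_sqrt_le_mono)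
qed

(* Columns e_1, e_3, ..., e_{2k-1}, e_2, e_4, ..., e_{2k}; unit_vec counts from 0. *)
definition P_mat :: "nat \<Rightarrow> real mat" where
  "P_mat k = mat_of_cols (2 * k)
     (map (\<lambda>j. unit_vec (2 * k) (2 * j)) [0..<k] @
      map (\<lambda>j. unit_vec (2 * k) (2 * j + 1)) [0..<k])"

(* The set T_{2k}(P) of matrices P\<^sup>T R P with R upper triangular; no invertibility of R or
   condition on its diagonal is required. *)
definition T_mats :: "nat \<Rightarrow> real mat \<Rightarrow> real mat set" where
  "T_mats k P = {transpose_mat P * R * P | R.
     R \<in> carrier_mat (2 * k) (2 * k) \<and> upper_triangular R}"

definition is_SR_decomposition ::
    "nat \<Rightarrow> nat \<Rightarrow> real mat \<Rightarrow> real mat \<Rightarrow> real mat \<Rightarrow> bool" where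
  "is_SR_decomposition k n A S R \<longleftrightarrow>
     A = S * R \<and> S \<in> Sp k n \<and> R \<in> T_mats k (P_mat k)"

definition has_SR_decomposition :: "nat \<Rightarrow> nat \<Rightarrow> real mat \<Rightarrow> bool" where
  "has_SR_decomposition k n A \<longleftrightarrow> (\<exists>S R. is_SR_decomposition k n A S R)"

end

theory Submission
  imports Defs "Jordan_Normal_Form.Determinant"
begin

text \<open>
  Write \<open>A = X + Z\<close>. Because \<open>Z\<close> is tangent at \<open>X\<close>, the terms of first order in \<open>Z\<close> cancel in
  the symplectic Gram matrix of \<open>A\<close>, so \<open>A\<^sup>T J A = J + Z\<^sup>T J Z\<close>
  (\<open>Gram_matrix_tangent_step\<close>). Conjugation by the permutation \<open>P\<close> interleaves the two halves
  of the coordinates and turns the form \<open>J\<close> into the block diagonal matrix \<open>K\<close> with \<open>k\<close> blocks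
  \<open>((0, 1), (-1, 0))\<close>, called \<open>interleaved_J\<close> below. With \<open>M = Z P\<^sup>T\<close> the Gram matrix becomes
  \<open>G = K + M\<^sup>T J M\<close>, and an SR decomposition of \<open>A\<close> can be read off from a Cholesky-like
  factorization \<open>G = R\<^sup>T K R\<close> with \<open>R\<close> upper triangular and invertible: the matrix
  \<open>S = A (P\<^sup>T R P)\<^sup>-\<^sup>1\<close> then satisfies \<open>S\<^sup>T J S = P\<^sup>T K P = J\<close> (\<open>has_SR_decompositionI\<close>).

  As for the LU and Cholesky factorizations, block elimination shows that a skew-symmetric \<open>G\<close>
  has such a factor \<open>R\<close> as soon as its leading principal minors of even order are nonzero
  (\<open>skew_triangular_factorization\<close>); those of odd order always vanish. This is where the bound
  on the norm enters. A leading block of \<open>G\<close> of even order again has the form \<open>K + M\<^sup>T J M\<close>,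
  with fewer columns in \<open>M\<close>, and \<open>M\<close> still shrinks all nonzero vectors. Since \<open>K\<close> and \<open>J\<close>
  are isometries, \<open>M\<^sup>T J M v\<close> is strictly shorter than \<open>K v\<close> and cannot cancel it
  (\<open>det_isometry_plus_contraction_nonzero\<close>).
\<close>

section \<open>Inverses, isometries and contractions\<close>

lemma det_nonzero_obtain_inverse:
  fixes A :: "'a :: field mat"
  assumes A: "A \<in> carrier_mat n n" and "det A \<noteq> 0"
  obtains B where "B \<in> carrier_mat n n" "A * B = 1\<^sub>m n" "B * A = 1\<^sub>m n"
  using det_non_zero_imp_unit[OF assms, of "()"] that
  unfolding Units_def by (auto simp: ring_mat_def)

lemma isometry_scalar_prod:
  fixes Q :: "'a :: comm_semiring_1 mat"
  assumes Q: "Q \<in> carrier_mat m r" and "transpose_mat Q * Q = 1\<^sub>m r" and v: "v \<in> carrier_vec r"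
  shows "(Q *\<^sub>v v) \<bullet> (Q *\<^sub>v v) = v \<bullet> v"
proof -
  have "(Q *\<^sub>v v) \<bullet> (Q *\<^sub>v v) = (transpose_mat Q *\<^sub>v (Q *\<^sub>v v)) \<bullet> v"
    by (rule transpose_vec_mult_scalar[symmetric]) (use Q v in auto)
  also have "transpose_mat Q *\<^sub>v (Q *\<^sub>v v) = (transpose_mat Q * Q) *\<^sub>v v"
    by (rule assoc_mult_mat_vec[symmetric]) (use Q v in auto)
  finally show ?thesis
    using assms by simp
qed

text \<open>
  The condition is stated with squared norms, so that the arguments below stay within the algebra
  of scalar products and never have to take a square root.
\<close>

definition strict_contraction :: "real mat \<Rightarrow> bool" where
  "strict_contraction M \<longleftrightarrow>
     (\<forall>v \<in> carrier_vec (dim_col M). v \<noteq> 0\<^sub>v (dim_col M) \<longrightarrow> (M *\<^sub>v v) \<bullet> (M *\<^sub>v v) < v \<bullet> v)"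

lemma real_scalar_prod_self_nonneg: "0 \<le> v \<bullet> (v :: real vec)"
  unfolding scalar_prod_def by (rule sum_nonneg) simp

lemma real_scalar_prod_self_eq_0_iff:
  assumes "v \<in> carrier_vec n"
  shows "v \<bullet> (v :: real vec) = 0 \<longleftrightarrow> v = 0\<^sub>v n"
  using assms unfolding scalar_prod_def by (auto simp: sum_nonneg_eq_0_iff)

text \<open>
  A nonzero vector rescaled to length 1 competes in the supremum that defines the spectral norm,
  and both sides of the inequality scale by the same factor.
\<close>

lemma spectral_norm_less_1_imp_strict_contraction:
  assumes "spectral_norm M < 1"
  shows "strict_contraction M"
  unfolding strict_contraction_def
proof (intro ballI impI)
  fix v :: "real vec"
  assume v: "v \<in> carrier_vec (dim_col M)" and nz: "v \<noteq> 0\<^sub>v (dim_col M)"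
  have pos: "v \<bullet> v > 0"
    using real_scalar_prod_self_nonneg[of v] real_scalar_prod_self_eq_0_iff[OF v] nz by linarith
  define c where "c = inverse (euclid_norm v)"
  have c: "c\<^sup>2 * (v \<bullet> v) = 1"
    using pos by (simp add: c_def euclid_norm_def power_inverse)
  define w where "w = c \<cdot>\<^sub>v v"
  have w: "w \<in> carrier_vec (dim_col M)"
    using v by (simp add: w_def)
  have "euclid_norm w \<le> 1"
    using c v by (simp add: euclid_norm_def w_def power2_eq_square mult.assoc)
  then have "euclid_norm (M *\<^sub>v w) \<le> spectral_norm M"
    unfolding spectral_norm_def
    by (intro cSUP_upper spectral_norm_bdd_above) (use w in auto)
  then have "sqrt ((M *\<^sub>v w) \<bullet> (M *\<^sub>v w)) < 1"
    using assms unfolding euclid_norm_def by (rule le_less_trans)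
  then have "(M *\<^sub>v w) \<bullet> (M *\<^sub>v w) < 1"
    by simp
  moreover have "M *\<^sub>v w = c \<cdot>\<^sub>v (M *\<^sub>v v)"
    unfolding w_def by (rule mult_mat_vec) (use v in auto)
  ultimately have "c\<^sup>2 * ((M *\<^sub>v v) \<bullet> (M *\<^sub>v v)) < c\<^sup>2 * (v \<bullet> v)"
    using c by (simp add: power2_eq_square mult.assoc)
  then show "(M *\<^sub>v v) \<bullet> (M *\<^sub>v v) < v \<bullet> v"
    by (simp add: mult_less_cancel_left)
qed

lemma strict_contraction_mult_isometry:
  assumes M: "M \<in> carrier_mat p m" and Q: "Q \<in> carrier_mat m r"
    and iso: "transpose_mat Q * Q = 1\<^sub>m r" and contr: "strict_contraction M"
  shows "strict_contraction (M * Q)"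
  unfolding strict_contraction_def
proof (intro ballI impI)
  fix v :: "real vec"
  assume "v \<in> carrier_vec (dim_col (M * Q))" and "v \<noteq> 0\<^sub>v (dim_col (M * Q))"
  with Q have v: "v \<in> carrier_vec r" and nz: "v \<noteq> 0\<^sub>v r" by auto
  have Qv: "Q *\<^sub>v v \<in> carrier_vec m" using Q v by auto
  note norm = isometry_scalar_prod[OF Q iso v]
  have "Q *\<^sub>v v \<noteq> 0\<^sub>v m"
    using norm nz real_scalar_prod_self_eq_0_iff[OF v] real_scalar_prod_self_eq_0_iff[OF Qv] by auto
  moreover have "(M * Q) *\<^sub>v v = M *\<^sub>v (Q *\<^sub>v v)"
    by (rule assoc_mult_mat_vec[OF M Q v])
  ultimately show "((M * Q) *\<^sub>v v) \<bullet> ((M * Q) *\<^sub>v v) < v \<bullet> v"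
    using contr M Qv norm unfolding strict_contraction_def by auto
qed

section \<open>Selecting rows and columns\<close>

text \<open>
  Both the permutation \<open>P_mat\<close> and the inclusion of the first coordinates have unit vectors as
  columns. Treating them as instances of one construction reduces congruences by them to a
  substitution of indices.
\<close>

definition selection_mat :: "nat \<Rightarrow> (nat \<Rightarrow> nat) \<Rightarrow> nat \<Rightarrow> real mat" where
  "selection_mat m f r = mat_of_cols m (map (\<lambda>j. unit_vec m (f j)) [0..<r])"

lemma selection_mat_carrier [simp]: "selection_mat m f r \<in> carrier_mat m r"
  by (simp add: selection_mat_def carrier_matI)

lemma col_selection_mat: "j < r \<Longrightarrow> col (selection_mat m f r) j = unit_vec m (f j)"
  by (simp add: selection_mat_def)

lemma index_selection_mat_congruence:
  assumes G: "G \<in> carrier_mat m m" and i: "i < r" and j: "j < r"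
    and fi: "f i < m" and fj: "f j < m"
  shows "(transpose_mat (selection_mat m f r) * G * selection_mat m f r) $$ (i, j) = G $$ (f i, f j)"
proof -
  let ?Q = "selection_mat m f r"
  note Q = selection_mat_carrier[of m f r]
  have Qt: "transpose_mat ?Q \<in> carrier_mat r m" by simp
  have "transpose_mat ?Q * G * ?Q = transpose_mat ?Q * (G * ?Q)"
    by (rule assoc_mult_mat[OF Qt G Q])
  also have "\<dots> $$ (i, j) = row (transpose_mat ?Q) i \<bullet> col (G * ?Q) j"
    by (rule index_mult_mat) (use i j carrier_matD[OF Q] in auto)
  also have "row (transpose_mat ?Q) i = unit_vec m (f i)"
    using i carrier_matD[OF Q] by (simp add: col_selection_mat)
  also have "col (G * ?Q) j = G *\<^sub>v unit_vec m (f j)"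
    using col_mult2[OF G Q j] j by (simp add: col_selection_mat)
  also have "\<dots> = col G (f j)"
    using G fj by (intro eq_vecI) auto
  also have "unit_vec m (f i) \<bullet> col G (f j) = G $$ (f i, f j)"
    using G fi fj by simp
  finally show ?thesis .
qed

lemma selection_mat_isometry:
  assumes "\<And>i. i < r \<Longrightarrow> f i < m" and "inj_on f {..<r}"
  shows "transpose_mat (selection_mat m f r) * selection_mat m f r = 1\<^sub>m r"
proof -
  let ?Q = "selection_mat m f r"
  note Q = selection_mat_carrier[of m f r]
  have "transpose_mat ?Q * 1\<^sub>m m * ?Q = 1\<^sub>m r"
  proof (rule eq_matI)
    fix i j assume "i < dim_row (1\<^sub>m r :: real mat)" "j < dim_col (1\<^sub>m r :: real mat)"
    then have ij: "i < r" "j < r" by auto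
    then show "(transpose_mat ?Q * 1\<^sub>m m * ?Q) $$ (i, j) = 1\<^sub>m r $$ (i, j)"
      using assms index_selection_mat_congruence[of "1\<^sub>m m" m i r j f]
      by (auto dest: inj_onD)
  qed (use carrier_matD[OF Q] in auto)
  then show ?thesis
    using Q by (metis right_mult_one_mat transpose_carrier_mat)
qed

definition leading_block :: "real mat \<Rightarrow> nat \<Rightarrow> real mat" where
  "leading_block G r = mat r r (($$) G)"

text \<open>
  Being a congruence by an isometry is what makes the form \<open>K + M\<^sup>T J M\<close> pass to leading blocks.
\<close>

lemma leading_block_eq_selection:
  assumes "G \<in> carrier_mat m m" and "r \<le> m"
  shows "leading_block G r = transpose_mat (selection_mat m id r) * G * selection_mat m id r"
  using assms carrier_matD[OF selection_mat_carrier[of m id r]]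
  by (intro eq_matI)
     (simp_all add: leading_block_def index_selection_mat_congruence del: index_mult_mat(1))

section \<open>The interleaved symplectic form\<close>

definition interleaved_J :: "nat \<Rightarrow> real mat" where
  "interleaved_J k = mat (2 * k) (2 * k)
     (\<lambda>(i, j). if even i \<and> j = Suc i then 1 else if even j \<and> i = Suc j then -1 else 0)"

lemma interleaved_J_carrier [simp]: "interleaved_J k \<in> carrier_mat (2 * k) (2 * k)"
  by (simp add: interleaved_J_def)

lemma J_mat_carrier [simp]: "J_mat m \<in> carrier_mat (2 * m) (2 * m)"
  by (simp add: J_mat_def mult_2)

lemma leading_block_interleaved_J:
  "j \<le> k \<Longrightarrow> leading_block (interleaved_J k) (2 * j) = interleaved_J j"
  by (intro eq_matI) (auto simp: leading_block_def interleaved_J_def)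

lemma transpose_interleaved_J: "transpose_mat (interleaved_J k) = - interleaved_J k"
  by (intro eq_matI) (auto simp: interleaved_J_def)

lemma interleaved_J_Suc:
  "interleaved_J (Suc k) =
     four_block_mat (interleaved_J k) (0\<^sub>m (2 * k) 2) (0\<^sub>m 2 (2 * k)) (interleaved_J 1)"
  (is "_ = ?F")
proof (rule eq_matI)
  fix i j assume "i < dim_row ?F" "j < dim_col ?F"
  then have "i < 2 * k \<or> i = 2 * k \<or> i = Suc (2 * k)" "j < 2 * k \<or> j = 2 * k \<or> j = Suc (2 * k)"
    by (auto simp: interleaved_J_def)
  moreover have "even i \<longrightarrow> 2 * k \<noteq> Suc i" for i
    by presburger
  ultimately show "interleaved_J (Suc k) $$ (i, j) = ?F $$ (i, j)"
    by (elim disjE) (simp_all add: interleaved_J_def)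
qed (simp_all add: interleaved_J_def)

definition interleave :: "nat \<Rightarrow> nat \<Rightarrow> nat" where
  "interleave k j = (if j < k then 2 * j else 2 * (j - k) + 1)"

lemma interleave_less: "j < 2 * k \<Longrightarrow> interleave k j < 2 * k"
  by (auto simp: interleave_def)

lemma inj_on_interleave: "inj_on (interleave k) A"
  by (rule inj_onI) (auto simp: interleave_def split: if_splits; presburger)

lemma P_mat_eq_selection_mat: "P_mat k = selection_mat (2 * k) (interleave k) (2 * k)"
proof -
  have "map (\<lambda>j. unit_vec (2 * k) (2 * j)) [0..<k] @
      map (\<lambda>j. unit_vec (2 * k) (2 * j + 1)) [0..<k] =
      map (\<lambda>j. unit_vec (2 * k) (interleave k j)) [0..<2 * k]"
    by (rule nth_equalityI) (auto simp: nth_append interleave_def)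
  then show ?thesis
    unfolding P_mat_def selection_mat_def by (rule arg_cong)
qed

lemma P_mat_carrier [simp]: "P_mat k \<in> carrier_mat (2 * k) (2 * k)"
  by (simp add: P_mat_eq_selection_mat)

lemma P_mat_orthogonal:
  "transpose_mat (P_mat k) * P_mat k = 1\<^sub>m (2 * k)"
  "P_mat k * transpose_mat (P_mat k) = 1\<^sub>m (2 * k)"
proof -
  show *: "transpose_mat (P_mat k) * P_mat k = 1\<^sub>m (2 * k)"
    unfolding P_mat_eq_selection_mat
    by (intro selection_mat_isometry interleave_less inj_on_interleave)
  show "P_mat k * transpose_mat (P_mat k) = 1\<^sub>m (2 * k)"
    by (rule mat_mult_left_right_inverse[OF _ _ *]) auto
qed

lemma P_mat_congruence_interleaved_J:
  "transpose_mat (P_mat k) * interleaved_J k * P_mat k = J_mat k"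
proof (rule eq_matI)
  fix i j assume "i < dim_row (J_mat k)" "j < dim_col (J_mat k)"
  then have ij: "i < 2 * k" "j < 2 * k" by (auto simp: J_mat_def)
  then have "(transpose_mat (P_mat k) * interleaved_J k * P_mat k) $$ (i, j) =
      interleaved_J k $$ (interleave k i, interleave k j)"
    unfolding P_mat_eq_selection_mat
    by (intro index_selection_mat_congruence interleave_less) auto
  also have "\<dots> = J_mat k $$ (i, j)"
  proof -
    have [simp]: "Suc (2 * a) \<noteq> 2 * b" "2 * b \<noteq> Suc (2 * a)" for a b :: nat
      by presburger+
    show ?thesis
      using ij interleave_less[OF ij(1)] interleave_less[OF ij(2)]
      by (cases "i < k"; cases "j < k") (auto simp: interleaved_J_def J_mat_def interleave_def)
  qed
  finally show "(transpose_mat (P_mat k) * interleaved_J k * P_mat k) $$ (i, j) = J_mat k $$ (i, j)" .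
qed (use carrier_matD[OF P_mat_carrier[of k]] in \<open>auto simp: J_mat_def\<close>)

lemma J_mat_isometry: "transpose_mat (J_mat m) * J_mat m = 1\<^sub>m (2 * m)"
proof -
  have t: "transpose_mat (J_mat m) = four_block_mat (0\<^sub>m m m) (- 1\<^sub>m m) (1\<^sub>m m) (0\<^sub>m m m)"
    unfolding J_mat_def by (subst transpose_four_block_mat) (auto simp: transpose_uminus)
  show ?thesis
    unfolding t unfolding J_mat_def
    by (subst mult_four_block_mat[of _ m m _ m _ m _ _ m _ m]) (auto simp: mult_2 intro!: eq_matI)
qed

lemma transpose_J_mat: "transpose_mat (J_mat m) = - J_mat m"
  by (intro eq_matI) (auto simp: J_mat_def)

lemma P_mat_cancel_left:
  assumes "M \<in> carrier_mat (2 * k) r"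
  shows "P_mat k * (transpose_mat (P_mat k) * M) = M" "transpose_mat (P_mat k) * (P_mat k * M) = M"
proof -
  have Pt: "transpose_mat (P_mat k) \<in> carrier_mat (2 * k) (2 * k)" by simp
  show "P_mat k * (transpose_mat (P_mat k) * M) = M"
    using assms by (simp add: assoc_mult_mat[OF P_mat_carrier Pt assms, symmetric] P_mat_orthogonal)
  show "transpose_mat (P_mat k) * (P_mat k * M) = M"
    using assms by (simp add: assoc_mult_mat[OF Pt P_mat_carrier assms, symmetric] P_mat_orthogonal)
qed

lemma P_mat_conjugate_J_mat:
  "P_mat k * J_mat k * transpose_mat (P_mat k) = interleaved_J k"
  unfolding P_mat_congruence_interleaved_J[symmetric]
  by (simp add: mult_carrier_mat[of _ "2 * k" "2 * k" _ "2 * k"]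
        assoc_mult_mat[of _ "2 * k" "2 * k" _ "2 * k" _ "2 * k"]
      P_mat_cancel_left[of _ k "2 * k"] P_mat_orthogonal right_mult_one_mat[of _ "2 * k"])

lemma interleaved_J_isometry:
  "transpose_mat (interleaved_J k) * interleaved_J k = 1\<^sub>m (2 * k)"
proof -
  let ?P = "P_mat k" and ?J = "J_mat k"
  have "transpose_mat (interleaved_J k) = ?P * transpose_mat ?J * transpose_mat ?P"
    unfolding P_mat_conjugate_J_mat[symmetric]
    by (simp add: mult_carrier_mat[of _ "2 * k" "2 * k" _ "2 * k"]
        transpose_mult[of _ "2 * k" "2 * k" _ "2 * k"]
        assoc_mult_mat[of _ "2 * k" "2 * k" _ "2 * k" _ "2 * k"])
  then have "transpose_mat (interleaved_J k) * interleaved_J k =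
      ?P * transpose_mat ?J * transpose_mat ?P * (?P * ?J * transpose_mat ?P)"
    by (simp add: P_mat_conjugate_J_mat)
  also have "\<dots> = ?P * ((transpose_mat ?J * ?J) * transpose_mat ?P)"
    by (simp add: mult_carrier_mat[of _ "2 * k" "2 * k" _ "2 * k"]
        assoc_mult_mat[of _ "2 * k" "2 * k" _ "2 * k" _ "2 * k"]
        P_mat_cancel_left[of _ k "2 * k"])
  finally show ?thesis
    by (simp add: J_mat_isometry P_mat_orthogonal left_mult_one_mat[of _ "2 * k" "2 * k"])
qed

section \<open>Leading minors near the symplectic form\<close>

text \<open>
  Suppose that \<open>v \<noteq> 0\<close> lies in the kernel, and pair the equation \<open>K v + M\<^sup>T H M v = 0\<close> with
  \<open>u = K v\<close>. This gives \<open>u \<bullet> u = - a \<bullet> b\<close> for \<open>a = M u\<close> and \<open>b = H M v\<close>, although both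
  \<open>a\<close> and \<open>b\<close> are strictly shorter than \<open>u\<close>. Expanding \<open>0 \<le> (a + b) \<bullet> (a + b)\<close> makes the
  contradiction explicit and plays the part of the Cauchy-Schwarz inequality.
\<close>

lemma det_isometry_plus_contraction_nonzero:
  assumes K: "K \<in> carrier_mat r r" "transpose_mat K * K = 1\<^sub>m r"
    and H: "H \<in> carrier_mat p p" "transpose_mat H * H = 1\<^sub>m p"
    and M: "M \<in> carrier_mat p r" "strict_contraction M"
  shows "det (K + transpose_mat M * H * M) \<noteq> 0"
proof
  have Mt: "transpose_mat M \<in> carrier_mat r p" using M by simp
  have L: "transpose_mat M * H * M \<in> carrier_mat r r"
    using M H by (metis mult_carrier_mat Mt)
  assume "det (K + transpose_mat M * H * M) = 0"
  with K L obtain v where v: "v \<in> carrier_vec r" "v \<noteq> 0\<^sub>v r"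
    and ker: "(K + transpose_mat M * H * M) *\<^sub>v v = 0\<^sub>v r"
    using det_0_iff_vec_prod_zero_field[of "K + transpose_mat M * H * M" r] by auto
  define u where "u = K *\<^sub>v v"
  define a where "a = M *\<^sub>v u"
  define b where "b = H *\<^sub>v (M *\<^sub>v v)"
  have u: "u \<in> carrier_vec r" unfolding u_def using K v by auto
  have Mv: "M *\<^sub>v v \<in> carrier_vec p" using M v by auto
  have a: "a \<in> carrier_vec p" unfolding a_def using M u by auto
  have b: "b \<in> carrier_vec p" unfolding b_def using H Mv by auto
  have uu: "u \<bullet> u = v \<bullet> v"
    unfolding u_def by (rule isometry_scalar_prod[OF K v(1)])
  then have "u \<noteq> 0\<^sub>v r"
    using v real_scalar_prod_self_eq_0_iff[OF u] real_scalar_prod_self_eq_0_iff[OF v(1)] by auto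
  then have aa: "a \<bullet> a < u \<bullet> u"
    using M u unfolding strict_contraction_def a_def by auto
  have bb: "b \<bullet> b < v \<bullet> v"
    unfolding b_def isometry_scalar_prod[OF H Mv] using M v unfolding strict_contraction_def by auto
  have "(K + transpose_mat M * H * M) *\<^sub>v v = u + transpose_mat M * H * M *\<^sub>v v"
    unfolding u_def by (rule add_mult_distrib_mat_vec[OF K(1) L v(1)])
  also have "transpose_mat M * H * M *\<^sub>v v = transpose_mat M *\<^sub>v b"
    unfolding b_def
    using assoc_mult_mat_vec[OF mult_carrier_mat[OF Mt H(1)] M(1) v(1)]
      assoc_mult_mat_vec[OF Mt H(1) Mv] by simp
  finally have "u + transpose_mat M *\<^sub>v b = 0\<^sub>v r"
    using ker by (rule trans[OF sym])
  then have "(u + transpose_mat M *\<^sub>v b) \<bullet> u = 0"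
    using u by simp
  moreover have "(u + transpose_mat M *\<^sub>v b) \<bullet> u = u \<bullet> u + (transpose_mat M *\<^sub>v b) \<bullet> u"
    by (rule add_scalar_prod_distrib) (use u Mt b in auto)
  moreover have "(transpose_mat M *\<^sub>v b) \<bullet> u = b \<bullet> a"
    unfolding a_def by (rule transpose_vec_mult_scalar[OF M(1) u b])
  ultimately have ba: "b \<bullet> a = - (u \<bullet> u)" by simp
  have "(a + b) \<bullet> (a + b) = a \<bullet> a + 2 * (b \<bullet> a) + b \<bullet> b"
    using a b scalar_prod_add_distrib[of "a + b" p a b] add_scalar_prod_distrib[of a p b]
      comm_scalar_prod[OF a b] by simp
  then show False
    using real_scalar_prod_self_nonneg[of "a + b"] aa bb uu ba by simp
qed

lemma leading_minor_interleaved_J_plus_contraction_nonzero: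
  assumes M: "M \<in> carrier_mat (2 * n) (2 * k)" "strict_contraction M" and j: "j \<le> k"
  shows "det (leading_block (interleaved_J k + transpose_mat M * J_mat n * M) (2 * j)) \<noteq> 0"
proof -
  let ?E = "selection_mat (2 * k) id (2 * j)"
  have E: "?E \<in> carrier_mat (2 * k) (2 * j)" and Et: "transpose_mat ?E \<in> carrier_mat (2 * j) (2 * k)"
    by simp_all
  have iso: "transpose_mat ?E * ?E = 1\<^sub>m (2 * j)"
    by (rule selection_mat_isometry) (use j in auto)
  have Mt: "transpose_mat M \<in> carrier_mat (2 * k) (2 * n)" using M by simp
  note J = J_mat_carrier[of n]
  have L: "transpose_mat M * J_mat n * M \<in> carrier_mat (2 * k) (2 * k)"
    using mult_carrier_mat[OF mult_carrier_mat[OF Mt J] M(1)] .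
  have ME: "M * ?E \<in> carrier_mat (2 * n) (2 * j)" by (rule mult_carrier_mat[OF M(1) E])
  have "leading_block (interleaved_J k + transpose_mat M * J_mat n * M) (2 * j) =
      leading_block (interleaved_J k) (2 * j) + leading_block (transpose_mat M * J_mat n * M) (2 * j)"
    using j carrier_matD[OF L] by (intro eq_matI) (auto simp: leading_block_def)
  also have "leading_block (interleaved_J k) (2 * j) = interleaved_J j"
    by (rule leading_block_interleaved_J[OF j])
  also have "leading_block (transpose_mat M * J_mat n * M) (2 * j) =
      transpose_mat ?E * (transpose_mat M * J_mat n * M) * ?E"
    by (rule leading_block_eq_selection[OF L]) (use j in simp)
  also have "\<dots> = transpose_mat (M * ?E) * J_mat n * (M * ?E)"
  proof -
    have "transpose_mat (M * ?E) = transpose_mat ?E * transpose_mat M"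
      by (rule transpose_mult[OF M(1) E])
    moreover have "transpose_mat ?E * (transpose_mat M * J_mat n * M) * ?E =
        transpose_mat ?E * ((transpose_mat M * J_mat n) * M * ?E)"
      by (rule assoc_mult_mat[OF Et L E])
    moreover have "transpose_mat M * J_mat n * M * ?E = transpose_mat M * J_mat n * (M * ?E)"
      by (rule assoc_mult_mat[OF mult_carrier_mat[OF Mt J] M(1) E])
    moreover have "transpose_mat ?E * (transpose_mat M * J_mat n * (M * ?E)) =
        transpose_mat ?E * (transpose_mat M * J_mat n) * (M * ?E)"
      by (rule assoc_mult_mat[OF Et mult_carrier_mat[OF Mt J] ME, symmetric])
    moreover have "transpose_mat ?E * (transpose_mat M * J_mat n) =
        transpose_mat ?E * transpose_mat M * J_mat n"
      by (rule assoc_mult_mat[OF Et Mt J, symmetric])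
    ultimately show ?thesis by simp
  qed
  finally show ?thesis
    using det_isometry_plus_contraction_nonzero[OF interleaved_J_carrier interleaved_J_isometry
        J_mat_carrier J_mat_isometry ME strict_contraction_mult_isometry[OF M(1) E iso M(2)]]
    by simp
qed

section \<open>Triangular factorization of skew-symmetric matrices\<close>

text \<open>
  A skew-symmetric matrix of order 2 is a multiple \<open>d\<close> of the standard one, and the factor
  \<open>diag(1, d)\<close> realizes any real \<open>d\<close>. A positive diagonal of the factor would require \<open>d > 0\<close>.
\<close>

lemma skew_2x2_factorization:
  assumes D: "D \<in> carrier_mat 2 2" and skew: "transpose_mat D = - D"
  obtains R :: "real mat" where "R \<in> carrier_mat 2 2" "upper_triangular R"
    "transpose_mat R * interleaved_J 1 * R = D"
proof
  define R where "R = mat 2 2 (\<lambda>(i, j). if i \<noteq> j then 0 else if i = 0 then 1 else D $$ (0, 1))"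
  show R: "R \<in> carrier_mat 2 2" by (simp add: R_def)
  show "upper_triangular R" by (auto simp: R_def)
  have entry: "D $$ (j, i) = - D $$ (i, j)" if "i < 2" "j < 2" for i j
    using that D arg_cong[OF skew, of "\<lambda>A. A $$ (i, j)"] by auto
  show "transpose_mat R * interleaved_J 1 * R = D"
  proof (rule eq_matI)
    fix i j assume "i < dim_row D" "j < dim_col D"
    then have ij: "i = 0 \<or> i = 1" "j = 0 \<or> j = 1" using D by auto
    then show "(transpose_mat R * interleaved_J 1 * R) $$ (i, j) = D $$ (i, j)"
      using entry[of 0 0] entry[of 1 1] entry[of 0 1]
      by (elim disjE) (simp_all add: R_def interleaved_J_def scalar_prod_def numeral_2_eq_2)
  qed (use R D in auto)
qed

text \<open>
  The induction splits off the last two rows and columns. If \<open>R0\<close> factors the leading block, the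
  ansatz \<open>R = ((R0, C), (0, R1))\<close> leads to the equations \<open>R0\<^sup>T K C = G1\<close> for the upper right
  block and \<open>R1\<^sup>T K R1 = G3 - C\<^sup>T K C\<close> for the lower right one. The first is solvable because the
  determinant of \<open>R0\<^sup>T K\<close> is a factor of the leading minor \<open>det G0 \<noteq> 0\<close>; the right-hand side of
  the second is a skew-symmetric matrix of order 2; and the lower left block comes out right by
  skew-symmetry.
\<close>

lemma skew_triangular_factorization:
  assumes "G \<in> carrier_mat (2 * k) (2 * k)" and "transpose_mat G = - G"
    and "\<And>j. j \<le> k \<Longrightarrow> det (leading_block G (2 * j)) \<noteq> 0"
  shows "\<exists>R \<in> carrier_mat (2 * k) (2 * k).
    upper_triangular R \<and> transpose_mat R * interleaved_J k * R = G"
  using assms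
proof (induction k arbitrary: G)
  case 0
  then show ?case
    by (intro bexI[of _ "1\<^sub>m 0"] conjI eq_matI) auto
next
  case (Suc k)
  let ?m = "2 * k"
  note G = Suc.prems(1) and skew = Suc.prems(2) and minors = Suc.prems(3)
  obtain G0 G1 G2 G3 where split: "split_block G ?m ?m = (G0, G1, G2, G3)"
    by (cases "split_block G ?m ?m")
  have dims: "dim_row G = ?m + 2" "dim_col G = ?m + 2" using G by auto
  note blocks = split_block[OF split dims]
  have entry: "G $$ (j, i) = - G $$ (i, j)" if "i < ?m + 2" "j < ?m + 2" for i j
    using that dims arg_cong[OF skew, of "\<lambda>A. A $$ (i, j)"] by auto
  have G0: "G0 = leading_block G ?m" and skew0: "transpose_mat G0 = - G0"
    and G2: "G2 = - transpose_mat G1" and skew3: "transpose_mat G3 = - G3"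
    using split dims
    by (auto simp: split_block_def Let_def leading_block_def entry[symmetric] intro!: eq_matI)
  have "leading_block G0 (2 * j) = leading_block G (2 * j)" if "j \<le> k" for j
    using that by (intro eq_matI) (auto simp: G0 leading_block_def)
  with minors have "det (leading_block G0 (2 * j)) \<noteq> 0" if "j \<le> k" for j
    using that by simp
  with Suc.IH[OF blocks(1) skew0] obtain R0 where R0: "R0 \<in> carrier_mat ?m ?m"
    "upper_triangular R0" and fact0: "transpose_mat R0 * interleaved_J k * R0 = G0"
    by blast
  define N where "N = transpose_mat R0 * interleaved_J k"
  have R0t: "transpose_mat R0 \<in> carrier_mat ?m ?m" using R0 by simp
  have N: "N \<in> carrier_mat ?m ?m"
    unfolding N_def by (rule mult_carrier_mat[OF R0t interleaved_J_carrier])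
  have "det N * det R0 = det G0"
    using det_mult[OF N R0(1)] fact0 by (simp add: N_def)
  also have "\<dots> \<noteq> 0"
    using minors[of k] by (simp add: G0)
  finally have "det N \<noteq> 0" by auto
  then obtain N' where N': "N' \<in> carrier_mat ?m ?m" "N * N' = 1\<^sub>m ?m"
    using det_nonzero_obtain_inverse[OF N] by blast
  define C where "C = N' * G1"
  have C: "C \<in> carrier_mat ?m 2"
    unfolding C_def by (rule mult_carrier_mat[OF N'(1) blocks(2)])
  have Ct: "transpose_mat C \<in> carrier_mat 2 ?m" using C by simp
  let ?J = "interleaved_J k"
  note J = interleaved_J_carrier[of k]
  have NC: "N * C = G1"
    unfolding C_def using assoc_mult_mat[OF N N'(1) blocks(2)] N'(2) blocks(2) by simp
  have transpose_form: "transpose_mat (transpose_mat A * ?J * B) = - (transpose_mat B * ?J * A)"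
    if A: "A \<in> carrier_mat ?m p" and B: "B \<in> carrier_mat ?m q" for A B p q
  proof -
    have At: "transpose_mat A \<in> carrier_mat p ?m" using A by simp
    have Bt: "transpose_mat B \<in> carrier_mat q ?m" using B by simp
    have "transpose_mat (transpose_mat A * ?J * B) = transpose_mat B * (transpose_mat ?J * A)"
      using transpose_mult[OF mult_carrier_mat[OF At J] B] transpose_mult[OF At J] by simp
    also have "\<dots> = - (transpose_mat B * (?J * A))"
      using A B carrier_matD[OF J] by (simp add: transpose_interleaved_J)
    also have "transpose_mat B * (?J * A) = transpose_mat B * ?J * A"
      by (rule assoc_mult_mat[OF Bt J A, symmetric])
    finally show ?thesis .
  qed
  have CR0: "transpose_mat C * ?J * R0 = G2"
    using transpose_form[OF R0(1) C] NC by (simp add: N_def G2)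
  define F where "F = transpose_mat C * ?J * C"
  have F: "F \<in> carrier_mat 2 2"
    unfolding F_def by (rule mult_carrier_mat[OF mult_carrier_mat[OF Ct J] C])
  have "transpose_mat F = - F"
    unfolding F_def by (rule transpose_form[OF C C])
  then have "transpose_mat (G3 - F) = - (G3 - F)"
    using skew3 F blocks(4) by (simp add: transpose_minus) (auto intro!: eq_matI)
  then obtain R1 where R1: "R1 \<in> carrier_mat 2 2" "upper_triangular R1"
    and fact1: "transpose_mat R1 * interleaved_J 1 * R1 = G3 - F"
    using skew_2x2_factorization[of "G3 - F"] F by (metis minus_carrier_mat)
  define R where "R = four_block_mat R0 C (0\<^sub>m 2 ?m) R1"
  have R1t: "transpose_mat R1 \<in> carrier_mat 2 2" using R1 by simp
  have J1: "interleaved_J 1 \<in> carrier_mat 2 2" using interleaved_J_carrier[of 1] by simp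
  have R1J: "transpose_mat R1 * interleaved_J 1 \<in> carrier_mat 2 2"
    by (rule mult_carrier_mat[OF R1t J1])
  have CJ: "transpose_mat C * ?J \<in> carrier_mat 2 ?m"
    by (rule mult_carrier_mat[OF Ct J])
  have "transpose_mat R = four_block_mat (transpose_mat R0) (0\<^sub>m ?m 2) (transpose_mat C) (transpose_mat R1)"
    unfolding R_def by (subst transpose_four_block_mat[OF R0(1) C _ R1(1)]) auto
  moreover have "four_block_mat (transpose_mat R0) (0\<^sub>m ?m 2) (transpose_mat C) (transpose_mat R1)
      * interleaved_J (Suc k) =
      four_block_mat N (0\<^sub>m ?m 2) (transpose_mat C * ?J) (transpose_mat R1 * interleaved_J 1)"
    unfolding interleaved_J_Suc
    by (subst mult_four_block_mat[OF R0t _ Ct R1t J _ _ J1])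
      (use R0t Ct R1t J1 N R1J CJ in \<open>auto simp: N_def[symmetric]\<close>)
  moreover have "four_block_mat N (0\<^sub>m ?m 2) (transpose_mat C * ?J) (transpose_mat R1 * interleaved_J 1)
      * R = four_block_mat G0 G1 G2 (F + (G3 - F))"
    unfolding R_def
    by (subst mult_four_block_mat[OF N _ CJ R1J R0(1) C _ R1(1)])
      (use N R1J CJ R1(1) blocks C R0(1) fact0 CR0 NC fact1 in
        \<open>auto simp: N_def[symmetric] F_def[symmetric]\<close>)
  moreover have "F + (G3 - F) = G3"
    using F blocks(4) by (intro eq_matI) auto
  ultimately have "transpose_mat R * interleaved_J (Suc k) * R = G"
    using blocks(5) by simp
  moreover have "upper_triangular R"
    unfolding R_def by (rule upper_triangular_four_block) (use R0 R1 in auto)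
  moreover have "R \<in> carrier_mat (2 * Suc k) (2 * Suc k)"
    using four_block_carrier_mat[OF R0(1) R1(1)] by (simp add: R_def)
  ultimately show ?case by blast
qed

section \<open>The SR decomposition\<close>

lemma Gram_matrix_tangent_step:
  assumes X: "X \<in> Sp k n" and Z: "Z \<in> tangent_Sp k n X"
  shows "transpose_mat (X + Z) * J_mat n * (X + Z) = J_mat k + transpose_mat Z * J_mat n * Z"
proof -
  note J = J_mat_carrier[of n]
  have X': "X \<in> carrier_mat (2 * n) (2 * k)" and Z': "Z \<in> carrier_mat (2 * n) (2 * k)"
    using X Z by (auto simp: Sp_def tangent_Sp_def)
  have Xt: "transpose_mat X \<in> carrier_mat (2 * k) (2 * n)"
    and Zt: "transpose_mat Z \<in> carrier_mat (2 * k) (2 * n)"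
    using X' Z' by simp_all
  note XJ = mult_carrier_mat[OF Xt J] and ZJ = mult_carrier_mat[OF Zt J]
  have "transpose_mat (X + Z) * J_mat n * (X + Z) =
      (transpose_mat X * J_mat n + transpose_mat Z * J_mat n) * (X + Z)"
    using transpose_add[OF X' Z'] add_mult_distrib_mat[OF Xt Zt J] by simp
  also have "\<dots> = transpose_mat X * J_mat n * (X + Z) + transpose_mat Z * J_mat n * (X + Z)"
    by (rule add_mult_distrib_mat[OF XJ ZJ]) (use X' Z' in auto)
  also have "\<dots> = (transpose_mat X * J_mat n * X + transpose_mat X * J_mat n * Z) +
      (transpose_mat Z * J_mat n * X + transpose_mat Z * J_mat n * Z)"
    using mult_add_distrib_mat[OF XJ X' Z'] mult_add_distrib_mat[OF ZJ X' Z'] by simp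
  also have "\<dots> = transpose_mat X * J_mat n * X +
      (transpose_mat Z * J_mat n * X + transpose_mat X * J_mat n * Z) + transpose_mat Z * J_mat n * Z"
    using carrier_matD[OF mult_carrier_mat[OF XJ X']] carrier_matD[OF mult_carrier_mat[OF XJ Z']]
      carrier_matD[OF mult_carrier_mat[OF ZJ X']] carrier_matD[OF mult_carrier_mat[OF ZJ Z']]
    by (intro eq_matI) (simp_all del: index_mult_mat(1))
  also have "\<dots> = J_mat k + transpose_mat Z * J_mat n * Z"
    using X Z by (simp add: Sp_def tangent_Sp_def)
  finally show ?thesis .
qed

text \<open>
  The symplectic factor is \<open>S = A T\<^sup>-\<^sup>1\<close> with \<open>T = P\<^sup>T R P\<close>; the hypothesis on the Gram matrix says
  that \<open>A\<^sup>T J A = T\<^sup>T J T\<close>, so multiplying by \<open>T\<^sup>-\<^sup>1\<close> on both sides leaves \<open>J\<close>.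
\<close>

lemma has_SR_decompositionI:
  assumes A: "A \<in> carrier_mat (2 * n) (2 * k)" and R: "R \<in> carrier_mat (2 * k) (2 * k)"
    and ut: "upper_triangular R" and det: "det R \<noteq> 0"
    and gram: "transpose_mat A * J_mat n * A =
      transpose_mat (P_mat k) * (transpose_mat R * interleaved_J k * R) * P_mat k"
  shows "has_SR_decomposition k n A"
proof -
  let ?P = "P_mat k" and ?m = "2 * k"
  let ?Pt = "transpose_mat ?P" and ?J = "J_mat n"
  obtain V where V: "V \<in> carrier_mat ?m ?m" "R * V = 1\<^sub>m ?m" "V * R = 1\<^sub>m ?m"
    by (rule det_nonzero_obtain_inverse[OF R det])
  define W where "W = ?Pt * V * ?P"
  define T where "T = ?Pt * R * ?P"
  note sq = assoc_mult_mat[of _ ?m ?m _ ?m _ ?m]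
  note [simp] = mult_carrier_mat[of _ ?m ?m _ ?m] P_mat_cancel_left[of _ k ?m] P_mat_orthogonal
  have P: "?P \<in> carrier_mat ?m ?m" "?Pt \<in> carrier_mat ?m ?m" by simp_all
  have W: "W \<in> carrier_mat ?m ?m" and T: "T \<in> carrier_mat ?m ?m"
    unfolding W_def T_def using P V R by (meson mult_carrier_mat)+
  have RV: "R * (V * M) = M" and VR: "V * (R * M) = M" if "M \<in> carrier_mat ?m ?m" for M
    using that V assoc_mult_mat[OF R V(1) that] assoc_mult_mat[OF V(1) R that] by simp_all
  have WT: "W * T = 1\<^sub>m ?m" and TW: "T * W = 1\<^sub>m ?m"
    unfolding W_def T_def using V R by (simp_all add: sq RV VR)
  have gram': "transpose_mat A * ?J * A = transpose_mat T * J_mat k * T"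
  proof -
    have "transpose_mat T = ?Pt * transpose_mat R * ?P"
      unfolding T_def using R
      by (simp add: transpose_mult[of _ ?m ?m _ ?m] sq)
    then show ?thesis
      unfolding gram P_mat_congruence_interleaved_J[of k, symmetric] T_def
      using R by (simp add: sq)
  qed
  have At: "transpose_mat A \<in> carrier_mat ?m (2 * n)" using A by simp
  have Wt: "transpose_mat W \<in> carrier_mat ?m ?m" using W by simp
  have Tt: "transpose_mat T \<in> carrier_mat ?m ?m" using T by simp
  note J = J_mat_carrier[of n]
  define S where "S = A * W"
  have S: "S \<in> carrier_mat (2 * n) ?m"
    unfolding S_def by (rule mult_carrier_mat[OF A W])
  have "transpose_mat S * ?J * S = transpose_mat W * (transpose_mat A * ?J * A) * W"
  proof -
    have "transpose_mat S = transpose_mat W * transpose_mat A"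
      unfolding S_def by (rule transpose_mult[OF A W])
    moreover have "transpose_mat W * transpose_mat A * ?J = transpose_mat W * (transpose_mat A * ?J)"
      by (rule assoc_mult_mat[OF Wt At J])
    moreover have "transpose_mat W * (transpose_mat A * ?J) * S =
        transpose_mat W * (transpose_mat A * ?J * S)"
      by (rule assoc_mult_mat[OF Wt mult_carrier_mat[OF At J] S])
    moreover have "transpose_mat A * ?J * S = transpose_mat A * ?J * A * W"
      unfolding S_def by (rule assoc_mult_mat[OF mult_carrier_mat[OF At J] A W, symmetric])
    moreover have "transpose_mat W * (transpose_mat A * ?J * A * W) =
        transpose_mat W * (transpose_mat A * ?J * A) * W"
      by (rule assoc_mult_mat[OF Wt mult_carrier_mat[OF mult_carrier_mat[OF At J] A] W, symmetric])
    ultimately show ?thesis by simp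
  qed
  also have "\<dots> = (transpose_mat W * transpose_mat T) * J_mat k * (T * W)"
    unfolding gram' using W T Wt Tt by (simp add: sq)
  also have "transpose_mat W * transpose_mat T = 1\<^sub>m ?m"
    using transpose_mult[OF T W] TW by simp
  also have "1\<^sub>m ?m * J_mat k * (T * W) = J_mat k"
    by (simp add: TW left_mult_one_mat[of _ ?m ?m] right_mult_one_mat[of _ ?m ?m])
  finally have "S \<in> Sp k n"
    using S by (simp add: Sp_def)
  moreover have "A = S * T"
    unfolding S_def using A assoc_mult_mat[OF A W T] WT by simp
  moreover have "T \<in> T_mats k ?P"
    unfolding T_mats_def T_def using R ut by blast
  ultimately show ?thesis
    unfolding has_SR_decomposition_def is_SR_decomposition_def by blast
qed

theorem theorem3p8:
  fixes k n :: nat and X Z :: "real mat"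
  assumes "1 \<le> k" and "k \<le> n"
    and "X \<in> Sp k n"
    and "Z \<in> tangent_Sp k n X"
    and "spectral_norm Z < 1"
  shows "has_SR_decomposition k n (X + Z)"
proof -
  let ?P = "P_mat k" and ?m = "2 * k"
  let ?Pt = "transpose_mat ?P" and ?J = "J_mat n"
  note sq = assoc_mult_mat[of _ ?m ?m _ ?m _ ?m]
  note J = J_mat_carrier[of n]
  have Z: "Z \<in> carrier_mat (2 * n) ?m" and X: "X \<in> carrier_mat (2 * n) ?m"
    using assms by (auto simp: Sp_def tangent_Sp_def)
  have Zt: "transpose_mat Z \<in> carrier_mat ?m (2 * n)" using Z by simp
  have P: "?P \<in> carrier_mat ?m ?m" and Pt: "?Pt \<in> carrier_mat ?m ?m" by simp_all
  define L where "L = transpose_mat Z * ?J * Z"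
  have L: "L \<in> carrier_mat ?m ?m"
    unfolding L_def by (rule mult_carrier_mat[OF mult_carrier_mat[OF Zt J] Z])
  define M where "M = Z * ?Pt"
  have M: "M \<in> carrier_mat (2 * n) ?m"
    unfolding M_def by (rule mult_carrier_mat[OF Z Pt])
  have contr: "strict_contraction M"
    unfolding M_def
    by (rule strict_contraction_mult_isometry[OF Z Pt])
      (use assms in \<open>auto simp: P_mat_orthogonal intro: spectral_norm_less_1_imp_strict_contraction\<close>)
  define G where "G = interleaved_J k + transpose_mat M * ?J * M"
  have Mt: "transpose_mat M \<in> carrier_mat ?m (2 * n)" using M by simp
  have MJM: "transpose_mat M * ?J * M \<in> carrier_mat ?m ?m"
    by (rule mult_carrier_mat[OF mult_carrier_mat[OF Mt J] M])
  have G: "G \<in> carrier_mat ?m ?m"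
    unfolding G_def using MJM by simp
  have "transpose_mat (transpose_mat M * ?J * M) = transpose_mat M * (transpose_mat ?J * M)"
    using transpose_mult[OF mult_carrier_mat[OF Mt J] M] transpose_mult[OF Mt J] by simp
  also have "\<dots> = - (transpose_mat M * ?J * M)"
    using assoc_mult_mat[OF Mt J M] carrier_matD[OF J] M by (simp add: transpose_J_mat)
  finally have "transpose_mat G = - G"
    unfolding G_def using transpose_add[OF interleaved_J_carrier MJM] carrier_matD[OF MJM]
      carrier_matD[OF interleaved_J_carrier[of k]]
    by (simp add: transpose_interleaved_J) (auto intro!: eq_matI simp del: index_mult_mat(1))
  moreover have minors: "det (leading_block G (2 * j)) \<noteq> 0" if "j \<le> k" for j
    unfolding G_def by (rule leading_minor_interleaved_J_plus_contraction_nonzero[OF M contr that])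
  ultimately obtain R where R: "R \<in> carrier_mat ?m ?m" "upper_triangular R"
    and fact: "transpose_mat R * interleaved_J k * R = G"
    using skew_triangular_factorization[OF G] by blast
  have Rt: "transpose_mat R \<in> carrier_mat ?m ?m" using R by simp
  \<comment> \<open>The leading minor of full order is the determinant of \<open>G\<close>, which makes \<open>R\<close> invertible.\<close>
  have "leading_block G ?m = G"
    using G by (intro eq_matI) (auto simp: leading_block_def)
  then have "det G \<noteq> 0"
    using minors[of k] by simp
  moreover have "det G = det (transpose_mat R * interleaved_J k) * det R"
    unfolding fact[symmetric]
    by (rule det_mult[OF mult_carrier_mat[OF Rt interleaved_J_carrier] R(1)])
  ultimately have "det R \<noteq> 0" by auto
  moreover have "transpose_mat (X + Z) * ?J * (X + Z) = ?Pt * G * ?P"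
  proof -
    have "transpose_mat M = ?P * transpose_mat Z"
      unfolding M_def using transpose_mult[OF Z Pt] by simp
    then have "transpose_mat M * ?J * M = ?P * (transpose_mat Z * ?J) * (Z * ?Pt)"
      unfolding M_def using assoc_mult_mat[OF P Zt J] by simp
    also have "\<dots> = ?P * (transpose_mat Z * ?J) * Z * ?Pt"
      by (rule assoc_mult_mat[OF mult_carrier_mat[OF P mult_carrier_mat[OF Zt J]] Z Pt, symmetric])
    also have "?P * (transpose_mat Z * ?J) * Z = ?P * L"
      unfolding L_def by (rule assoc_mult_mat[OF P mult_carrier_mat[OF Zt J] Z])
    finally have "?Pt * (transpose_mat M * ?J * M) * ?P = L"
      using L by (simp add: mult_carrier_mat[of _ ?m ?m _ ?m] sq P_mat_cancel_left[of _ k ?m] P_mat_orthogonal)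
    moreover have "?Pt * G * ?P =
        ?Pt * interleaved_J k * ?P + ?Pt * (transpose_mat M * ?J * M) * ?P"
      unfolding G_def
      using mult_add_distrib_mat[OF Pt interleaved_J_carrier MJM]
        add_mult_distrib_mat[OF mult_carrier_mat[OF Pt interleaved_J_carrier]
          mult_carrier_mat[OF Pt MJM] P] by simp
    ultimately show ?thesis
      using Gram_matrix_tangent_step[OF assms(3,4)]
      by (simp add: P_mat_congruence_interleaved_J L_def)
  qed
  ultimately show ?thesis
    using has_SR_decompositionI[of "X + Z" n k R] R X Z fact by simp
qed

end
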